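(* Let $W$ be an irreducible $T$-module with endpoint $r$ and diameter $d=D-2r$. Then the following hold for $0\le i,j\le d$. (i) For a nonzero $u\in E_rW$, $$\langle E^*_{r+i}u,E^*_{r+j}u\rangle=\delta_{ij}\binom{d}{i}2^{-d}\|u\|^2,\qquad \langle E^{\varepsilon}_{r+i}u,E^{\varepsilon}_{r+j}u\rangle=\delta_{ij}\binom{d}{i}2^{-d}\|u\|^2.$$ (ii) For a nonzero $u^*\in E^*_rW$, $$\langle E^{\varepsilon}_{r+i}u^*,E^{\varepsilon}_{r+j}u^*\rangle=\delta_{ij}\binom{d}{i}2^{-d}\|u^*\|^2,\qquad \langle E_{r+i}u^*,E_{r+j}u^*\rangle=\delta_{ij}\binom{d}{i}2^{-d}\|u^*\|^2.$$ (iii) For a nonzero $u^{\varepsilon}\in E^{\varepsilon}_rW$, $$\langle E_{r+i}u^{\varepsilon},E_{r+j}u^{\varepsilon}\rangle=\delta_{ij}\binom{d}{i}2^{-d}\|u^{\varepsilon}\|^2,\qquad \langle E^*_{r+i}u^{\varepsilon},E^*_{r+j}u^{\varepsilon}\rangle=\delta_{ij}\binom{d}{i}2^{-d}\|u^{\varepsilon}\|^2.$$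
   Context: Let $D$ be a positive integer and let $Q_D$ be the $D$-cube: the graph with vertex set $X=\{0,1\}^D$, two vertices being adjacent iff they differ in exactly one coordinate; $\partial$ denotes path-length distance. $\mathrm{Mat}_X(\mathbb{C})$ is the algebra of complex matrices with rows and columns indexed by $X$, acting on $V=\mathbb{C}^X$ (column vectors) by left multiplication. $V$ carries the Hermitian inner product $\langle v,w\rangle=v^t\overline{w}$ (linear in the first argument), with $\|v\|^2=\langle v,v\rangle$. Write $\mathbf{i}^2=-1$. Let $A$ be the adjacency matrix of $Q_D$. Fix $x=(0,0,\ldots,0)\in X$. Let $A^*$ be the diagonal matrix in $\mathrm{Mat}_X(\mathbb{C})$ with $(y,y)$-entry $D-2\partial(x,y)$ for $y\in X$, and let $A^{\varepsilon}=-\mathbf{i}(AA^*-A^*A)/2$. Let $T$ be the subalgebra of $\mathrm{Mat}_X(\mathbb{C})$ generated by $A$ and $A^*$. The eigenvalues of $A$ are $\theta_i=D-2i$ $(0\le i\le D)$. For $0\le i\le D$: $E_i=\prod_{0\le j\le D,\,j\ne i}\frac{A-\theta_jI}{\theta_i-\theta_j}$ is the primitive idempotent of $A$ for $\theta_i$ (the orthogonal projection onto the $\theta_i$-eigenspace of $A$); $E_i^*$ is the diagonal matrix with $(y,y)$-entry $1$ if $\partial(x,y)=i$ and $0$ otherwise; and $E_i^{\varepsilon}=P^{-1}E_iP$, where $P=P_1^{\otimes D}$ (Kronecker power, $P_{yz}=\prod_{k=1}^D(P_1)_{y_kz_k}$, invertible) with $P_1=\begin{pmatrix}1&1\\-\mathbf{i}&\mathbf{i}\end{pmatrix}$,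 rows and columns indexed by $0,1$ in that order. ($E_i^*$ and $E_i^{\varepsilon}$ are the primitive idempotents of $A^*$ and $A^{\varepsilon}$ for the eigenvalue $D-2i$.) A $T$-module is a subspace $W\subseteq V$ with $BW\subseteq W$ for all $B\in T$; it is irreducible if $W\ne0$ and it contains no $T$-modules other than $0$ and $W$. The endpoint of an irreducible $T$-module $W$ is $r=\min\{i\mid 0\le i\le D,\ E_i^*W\neq0\}$ (it is known that also $r=\min\{i\mid E_iW\ne0\}$), and its diameter is $d=|\{i\mid 0\le i\le D,\ E_i^*W\ne0\}|-1$; it is known that $d=D-2r$ and $0\le r\le D/2$. *)

theory Defs
  imports "HOL-Analysis.Analysis"
begin

text \<open>
  The \<open>D\<close>-cube is modelled with coordinates indexed by an arbitrary finite type \<open>'n\<close>, so that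
  \<open>D = CARD('n)\<close> is an arbitrary positive integer. The letters \<open>0, 1\<close> are \<open>False, True\<close>.
\<close>

type_synonym 'n cube = "'n \<Rightarrow> bool"
type_synonym 'n cvec = "complex ^ 'n cube"
type_synonym 'n cmat = "complex ^ 'n cube ^ 'n cube"

definition cube_adj :: "('n::finite cube \<times> 'n cube) set" where
  "cube_adj = {(y, z). \<exists>!k. y k \<noteq> z k}"

definition cube_dist :: "'n::finite cube \<Rightarrow> 'n cube \<Rightarrow> nat" where
  "cube_dist y z = (LEAST m. (y, z) \<in> cube_adj ^^ m)"

definition base :: "'n cube" where
  "base = (\<lambda>_. False)"

definition theta :: "nat \<Rightarrow> nat \<Rightarrow> complex" where
  "theta D i = of_nat D - 2 * of_nat i"

definition adj_mat :: "'n::finite cmat" where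
  "adj_mat = (\<chi> y z. if (y, z) \<in> cube_adj then 1 else 0)"

definition dual_adj_mat :: "'n::finite cmat" where
  "dual_adj_mat =
    (\<chi> y z. if y = z then of_nat CARD('n) - 2 * of_nat (cube_dist base y) else 0)"

text \<open>Multiplication by the scalar matrix \<open>mat c\<close> expresses multiplication by \<open>c\<close>.\<close>

definition mat_subalgebra :: "(complex ^ 'a ^ 'a::finite) set \<Rightarrow> bool" where
  "mat_subalgebra S \<longleftrightarrow> mat 1 \<in> S \<and> (\<forall>B\<in>S. \<forall>C\<in>S. B + C \<in> S \<and> B ** C \<in> S) \<and>
     (\<forall>c. \<forall>B\<in>S. mat c ** B \<in> S)"

definition T_alg :: "'n::finite cmat set" where
  "T_alg = mat_subalgebra hull {adj_mat, dual_adj_mat}"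

text \<open>The product has to be taken over a list, since the type class multiplication on
  \<open>vec\<close> is the entrywise one.\<close>

definition E :: "nat \<Rightarrow> 'n::finite cmat" where
  "E i = foldr (\<lambda>j M. mat (1 / (theta CARD('n) i - theta CARD('n) j)) **
                        (adj_mat - mat (theta CARD('n) j)) ** M)
           (filter (\<lambda>j. j \<noteq> i) [0..<Suc CARD('n)]) (mat 1)"

definition E_star :: "nat \<Rightarrow> 'n::finite cmat" where
  "E_star i = (\<chi> y z. if y = z \<and> cube_dist base y = i then 1 else 0)"

fun P1 :: "bool \<Rightarrow> bool \<Rightarrow> complex" where
  "P1 False False = 1"
| "P1 False True = 1"
| "P1 True False = - \<i>"
| "P1 True True = \<i>"

definition P_mat :: "'n::finite cmat" where
  "P_mat = (\<chi> y z. \<Prod>k\<in>UNIV. P1 (y k) (z k))"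

definition E_eps :: "nat \<Rightarrow> 'n::finite cmat" where
  "E_eps i = matrix_inv P_mat ** E i ** P_mat"

definition apply_set :: "complex ^ 'a ^ 'a \<Rightarrow> (complex ^ 'a::finite) set \<Rightarrow> (complex ^ 'a) set" where
  "apply_set B W = (\<lambda>v. B *v v) ` W"

definition T_module :: "'n::finite cvec set \<Rightarrow> bool" where
  "T_module W \<longleftrightarrow> vec.subspace W \<and> (\<forall>B\<in>T_alg. apply_set B W \<subseteq> W)"

definition irreducible_T_module :: "'n::finite cvec set \<Rightarrow> bool" where
  "irreducible_T_module W \<longleftrightarrow> T_module W \<and> W \<noteq> {0} \<and>
     (\<forall>U. T_module U \<and> U \<subseteq> W \<longrightarrow> U = {0} \<or> U = W)"

definition module_support :: "'n::finite cvec set \<Rightarrow> nat set" where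
  "module_support W = {i. i \<le> CARD('n) \<and> apply_set (E_star i) W \<noteq> {0}}"

definition module_endpoint :: "'n::finite cvec set \<Rightarrow> nat" where
  "module_endpoint W = Min (module_support W)"

definition module_diameter :: "'n::finite cvec set \<Rightarrow> nat" where
  "module_diameter W = card (module_support W) - 1"

text \<open>The library's inner product on \<open>complex ^ 'a\<close> is the real part of this one; the norms agree.\<close>

definition herm :: "complex ^ 'a::finite \<Rightarrow> complex ^ 'a \<Rightarrow> complex" where
  "herm v w = (\<Sum>y\<in>UNIV. v $ y * cnj (w $ y))"

lemma herm_self: "herm v v = complex_of_real ((norm v)\<^sup>2)"
proof -
  have "herm v v = (\<Sum>y\<in>UNIV. complex_of_real ((norm (v $ y))\<^sup>2))"
    unfolding herm_def by (rule sum.cong) (simp_all flip: complex_norm_square)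
  also have "\<dots> = complex_of_real ((norm v)\<^sup>2)"
    by (simp add: norm_vec_def L2_set_def sum_nonneg)
  finally show ?thesis .
qed

lemma P_mat_mult_adjoint:
  "(P_mat :: 'n::finite cmat) ** (\<chi> y z. cnj (P_mat $ z $ y)) = mat (2 ^ CARD('n))"
proof -
  have "(\<Sum>z\<in>UNIV. (\<Prod>k\<in>UNIV. P1 (y k) (z k)) * cnj (\<Prod>k\<in>UNIV. P1 (w k) (z k)))
        = (if y = w then 2 ^ CARD('n) else 0)" for y w :: "'n cube"
  proof -
    have "(\<Sum>z\<in>UNIV. (\<Prod>k\<in>UNIV. P1 (y k) (z k)) * cnj (\<Prod>k\<in>UNIV. P1 (w k) (z k)))
      = (\<Sum>z\<in>PiE UNIV (\<lambda>_. UNIV). \<Prod>k\<in>UNIV. P1 (y k) (z k) * cnj (P1 (w k) (z k)))"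
      by (simp add: prod.distrib PiE_UNIV_domain)
    also have "\<dots> = (\<Prod>k\<in>UNIV. \<Sum>b\<in>UNIV. P1 (y k) b * cnj (P1 (w k) b))"
      by (rule prod_sum_PiE [symmetric]) auto
    also have "\<dots> = (\<Prod>k\<in>UNIV. if y k = w k then 2 else 0)"
    proof (rule prod.cong)
      fix k
      show "(\<Sum>b\<in>UNIV. P1 (y k) b * cnj (P1 (w k) b)) = (if y k = w k then 2 else 0)"
        by (cases "y k"; cases "w k") (simp_all add: UNIV_bool)
    qed simp
    also have "\<dots> = (if y = w then 2 ^ CARD('n) else 0)"
      by (auto simp: fun_eq_iff)
    finally show ?thesis .
  qed
  then show ?thesis
    by (simp add: P_mat_def matrix_matrix_mult_def mat_def vec_eq_iff)
qed

lemma invertible_P_mat: "invertible (P_mat :: 'n::finite cmat)"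
proof -
  let ?Q = "(\<chi> y z. cnj (P_mat $ z $ y)) :: 'n cmat"
  have "P_mat ** (?Q ** mat (1 / 2 ^ CARD('n))) = mat 1"
    unfolding matrix_mul_assoc P_mat_mult_adjoint
    by (simp add: matrix_matrix_mult_def mat_def vec_eq_iff if_distrib [of "\<lambda>x. x * _"] cong: if_cong)
  then show ?thesis
    using invertible_right_inverse by blast
qed

end

theory Submission
  imports Defs
begin

text \<open>
  \<open>A\<close>, \<open>A\<^sup>*\<close> and \<open>A\<^sup>\<epsilon>\<close> are Hermitian and satisfy the commutation relations of the Pauli
  matrices, so each pair \<open>X, Y\<close> of them comes with operators \<open>X - \<i>Z\<close> and \<open>X + \<i>Z\<close> that raise and
  lower \<open>Y\<close>-eigenvalues and are adjoint to each other. A vector \<open>u\<close> at the bottom of the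
  \<open>X\<close>-support of a module is annihilated by \<open>Y + \<i>Z\<close>, hence
  \<open>(X - \<i>Z)u = (\<theta>\<^sub>r + Y)u\<close> and \<open>(X + \<i>Z)u = (\<theta>\<^sub>r - Y)u\<close>. For the \<open>Y\<close>-components \<open>u\<^sub>k\<close> of \<open>u\<close>,
  adjointness turns this into \<open>(D - r - k) \<parallel>u\<^sub>k\<parallel>\<^sup>2 = (k + 1 - r) \<parallel>u\<^sub>k\<^sub>+\<^sub>1\<parallel>\<^sup>2\<close> with \<open>u\<^sub>k = 0\<close> unless
  \<open>r \<le> k \<le> D - r\<close>, which gives the binomial norms. In particular the \<open>Y\<close>-support contains
  \<open>{r..D - r}\<close>; by symmetry in \<open>X\<close> and \<open>Y\<close> the endpoints for \<open>A\<close>, \<open>A\<^sup>*\<close>, \<open>A\<^sup>\<epsilon>\<close> agree, and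
  replacing \<open>Y\<close> by \<open>-Y\<close> bounds the support from above, so \<open>d = D - 2r\<close>.
\<close>

section \<open>Spectral resolutions\<close>

lemma herm_add_left: "herm (v + w) z = herm v z + herm w z"
  and herm_diff_left: "herm (v - w) z = herm v z - herm w z"
  and herm_diff_right: "herm z (v - w) = herm z v - herm z w"
  and herm_scale_left: "herm (c *s v) z = c * herm v z"
  and herm_scale_right: "herm z (c *s v) = cnj c * herm z v"
  and herm_zero_right [simp]: "herm z 0 = 0"
  and herm_minus_left: "herm (- v) z = - herm v z"
  and herm_minus_right: "herm z (- v) = - herm z v"
  and cnj_herm: "cnj (herm v z) = herm z v"
  by (simp_all add: herm_def sum.distrib sum_subtractf sum_distrib_left sum_negf algebra_simps)

lemma herm_sum_left: "herm (sum f S) z = (\<Sum>k\<in>S. herm (f k) z)"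
  by (simp add: herm_def sum_distrib_right sum.swap[of _ UNIV])

lemma herm_sum_right: "herm z (sum f S) = (\<Sum>k\<in>S. herm z (f k))"
  by (simp add: herm_def sum_distrib_left sum.swap[of _ UNIV])

lemma herm_self_eq_0_iff: "herm v v = 0 \<longleftrightarrow> v = 0"
  by (simp add: herm_self)

definition hermitian :: "complex ^ 'a ^ 'a::finite \<Rightarrow> bool" where
  "hermitian M \<longleftrightarrow> (\<forall>v w. herm (M *v v) w = herm v (M *v w))"

lemma theta_of_int: "theta D k = of_int (int D - 2 * int k)"
  by (simp add: theta_def)

lemma cnj_theta [simp]: "cnj (theta D k) = theta D k"
  by (simp add: theta_def)

lemma theta_eq_iff [simp]: "theta D k = theta D l \<longleftrightarrow> k = l"
  by (auto simp: theta_def)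

lemma matrix_vector_mult_sum:
  fixes A :: "'k::comm_semiring_1 ^ 'a ^ 'b"
  shows "A *v (\<Sum>k\<in>S. f k) = (\<Sum>k\<in>S. A *v f k)"
  by (induction S rule: infinite_finite_induct) (simp_all add: matrix_vector_right_distrib)

text \<open>Applying \<open>X - t a\<close> to the sum kills \<open>f a\<close> and multiplies every
  other \<open>f k\<close> by the nonzero number \<open>t k - t a\<close>. The rescaled terms are
  eigenvectors for the same eigenvalues, so induction on \<open>S\<close> puts them into
  \<open>W\<close>, and \<open>f a\<close> is what remains.\<close>

lemma subspace_component_mem:
  fixes X :: "'k::field ^ 'a ^ 'a::finite"
  assumes "finite S" and W: "vec.subspace W" and inv: "\<And>v. v \<in> W \<Longrightarrow> X *v v \<in> W"
    and "\<And>k. k \<in> S \<Longrightarrow> X *v f k = t k *s f k" and "inj_on t S" and "(\<Sum>k\<in>S. f k) \<in> W" and "k \<in> S"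
  shows "f k \<in> W"
  using assms(1,4-)
proof (induction S arbitrary: f k rule: finite_induct)
  case (insert a S)
  let ?s = "\<Sum>k\<in>insert a S. f k"
  let ?g = "\<lambda>k. (t k - t a) *s f k"
  have "X *v ?s - t a *s ?s \<in> W"
    using insert.prems(3) W inv by (intro vec.subspace_diff vec.subspace_scale)
  also have "X *v ?s - t a *s ?s = (\<Sum>k\<in>insert a S. ?g k)"
    by (simp add: matrix_vector_mult_sum insert.prems(1) vec.scale_sum_right
        vec.scale_left_diff_distrib flip: sum_subtractf del: sum.insert)
  also have "\<dots> = (\<Sum>k\<in>S. ?g k)"
    using insert.hyps by simp
  finally have sum_mem: "(\<Sum>k\<in>S. ?g k) \<in> W" .
  have "X *v ?g k = t k *s ?g k" if "k \<in> S" for k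
    using insert.prems(1)[of k] that by (simp only: vector_scalar_commute vector_smult_assoc mult.commute insertI2)
  moreover have "inj_on t S"
    using insert.prems(2) by (rule inj_on_subset) blast
  ultimately have scaled: "?g k \<in> W" if "k \<in> S" for k
    using insert.IH[of ?g k] sum_mem that by blast
  have S: "f k \<in> W" if "k \<in> S" for k
  proof -
    have "t k \<noteq> t a"
      using insert.prems(2) insert.hyps(2) that by (auto simp: inj_on_def)
    then have "f k = inverse (t k - t a) *s ?g k"
      by (simp only: vector_smult_assoc left_inverse right_minus_eq) simp
    then show ?thesis
      using vec.subspace_scale[OF W scaled[OF that]] by metis
  qed
  have "f a = ?s - (\<Sum>k\<in>S. f k)"
    using insert.hyps by simp
  also have "\<dots> \<in> W"
    by (rule vec.subspace_diff[OF W insert.prems(3) vec.subspace_sum[OF W S]])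
  finally show ?case using S insert.prems(4) by auto
qed simp

text \<open>Later \<open>N k\<close> is the squared norm of the \<open>k\<close>-th component of a
  vector. Zeros propagate upwards from \<open>0\<close> until the factor \<open>k + 1 - r\<close>
  vanishes, and downwards from \<open>D\<close> until \<open>D - r - k\<close> does. In between, the
  quotients are those of consecutive binomial coefficients.\<close>

lemma binomial_recurrence:
  fixes N :: "nat \<Rightarrow> real"
  assumes "r \<le> D"
    and step: "\<And>k. k < D \<Longrightarrow> (real D - real r - real k) * N k = (real k + 1 - real r) * N (Suc k)"
    and first: "real r * N 0 = 0" and last: "real r * N D = 0" and "k \<le> D"
  shows "N k = (if r \<le> k \<and> k \<le> D - r then of_nat ((D - 2 * r) choose (k - r)) * N r else 0)"
proof -
  have low: "N k = 0" if "k < r" for k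
    using that
  proof (induction k)
    case 0
    then show ?case using first by simp
  next
    case (Suc k)
    then have "(real k + 1 - real r) * N (Suc k) = 0"
      using step[of k] \<open>r \<le> D\<close> by simp
    then show ?case using Suc.prems by auto
  qed
  \<comment> \<open>The distance \<open>m\<close> from the top is the induction variable, so that
    the descent from \<open>D\<close> is an ordinary induction.\<close>
  have high': "N (D - m) = 0" if "m < r" for m
    using that
  proof (induction m)
    case 0
    then show ?case using last by simp
  next
    case (Suc m)
    define k where "k = D - Suc m"
    have k: "k < D" "Suc k = D - m" "real k = real D - (real m + 1)"
      using Suc.prems \<open>r \<le> D\<close> by (auto simp: k_def of_nat_diff)
    then have "(real m + 1 - real r) * N k = 0"
      using step[OF k(1)] Suc unfolding k(2,3) by simp
    then show ?case using Suc.prems by (auto simp: k_def)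
  qed
  have high: "N k = 0" if "D - r < k" "k \<le> D" for k
    using high'[of "D - k"] that by simp
  have mid: "N (r + i) = of_nat ((D - 2 * r) choose i) * N r" if "r + i \<le> D - r" for i
    using that
  proof (induction i)
    case (Suc i)
    let ?d = "D - 2 * r"
    have i: "i < ?d" using Suc.prems by simp
    then have eq: "real (Suc i) * N (r + Suc i) = (real ?d - real i) * N (r + i)"
      using step[of "r + i"] Suc.prems by (simp add: of_nat_diff algebra_simps)
    \<comment> \<open>Both sides equal \<open>?d * ((?d - 1) choose i)\<close>.\<close>
    have "Suc i * (?d choose Suc i) = (?d - i) * (?d choose i)"
      by (simp only: binomial_absorption binomial_absorb_comp)
    then have "real (Suc i) * real (?d choose Suc i) = (real ?d - real i) * real (?d choose i)"
      using i by (metis of_nat_diff of_nat_mult less_imp_le)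
    then have "real (Suc i) * N (r + Suc i) = real (Suc i) * (real (?d choose Suc i) * N r)"
      using Suc eq by (simp del: of_nat_Suc binomial_Suc_Suc flip: mult.assoc)
    then show ?case by (simp del: of_nat_Suc)
  qed simp
  show ?thesis
    using low[of k] high[of k] mid[of "k - r"] \<open>k \<le> D\<close> by auto
qed

text \<open>For \<open>k\<close> \<le> \<open>D\<close> these conditions make \<open>F k\<close> the
  orthogonal projection onto the eigenspace of \<open>X\<close> for \<open>theta D k\<close>:
  distinct eigenvalues of a Hermitian matrix have orthogonal eigenvectors, and the components add up
  to the whole vector.\<close>

locale spectral_resolution =
  fixes D :: nat and X :: "complex ^ 'a ^ 'a::finite" and F :: "nat \<Rightarrow> complex ^ 'a ^ 'a"
  assumes herm: "hermitian X"
    and eigen: "k \<le> D \<Longrightarrow> X *v (F k *v v) = theta D k *s (F k *v v)"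
    and resolution: "(\<Sum>k\<le>D. F k *v v) = v"
begin

text \<open>Moving \<open>X\<close> across the form gives two real eigenvalues that can only agree
  if the form vanishes. An arbitrary integer \<open>m\<close> is allowed because ladder operators
  may shift an eigenvalue out of the spectrum.\<close>

lemma orthogonal_eigen:
  assumes w: "X *v w = of_int m *s w" and "k \<le> D" "m \<noteq> int D - 2 * int k"
  shows "herm w (F k *v v) = 0"
proof -
  have "of_int m * herm w (F k *v v) = herm (X *v w) (F k *v v)"
    by (simp add: w herm_scale_left)
  also have "\<dots> = theta D k * herm w (F k *v v)"
    using herm by (simp add: hermitian_def eigen \<open>k \<le> D\<close> herm_scale_right)
  finally show ?thesis
    using assms(3) by (simp add: theta_of_int flip: of_int_diff)
qed

lemma orthogonal: "k \<le> D \<Longrightarrow> l \<le> D \<Longrightarrow> k \<noteq> l \<Longrightarrow> herm (F k *v v) (F l *v w) = 0"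
  by (rule orthogonal_eigen[where m = "int D - 2 * int k"]) (simp_all add: eigen theta_of_int del: of_int_diff)

lemma herm_component_left:
  assumes "k \<le> D"
  shows "herm v (F k *v w) = herm (F k *v v) (F k *v w)"
proof -
  have "herm v (F k *v w) = (\<Sum>l\<le>D. herm (F l *v v) (F k *v w))"
    by (simp add: resolution flip: herm_sum_left)
  also have "\<dots> = (\<Sum>l\<le>D. if l = k then herm (F k *v v) (F k *v w) else 0)"
    using assms by (intro sum.cong) (auto simp: orthogonal)
  finally show ?thesis using assms by simp
qed

text \<open>Such a \<open>w\<close> is orthogonal to all of its own components, hence to itself.
  This is what stops the ladders at both ends of the spectrum.\<close>

lemma not_eigenvalue_imp_0:
  assumes "X *v w = of_int m *s w" and "\<And>k. k \<le> D \<Longrightarrow> m \<noteq> int D - 2 * int k"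
  shows "w = 0"
proof -
  have "herm w w = (\<Sum>k\<le>D. herm w (F k *v w))"
    by (simp add: resolution flip: herm_sum_right)
  also have "\<dots> = 0"
    using assms by (intro sum.neutral) (auto intro: orthogonal_eigen)
  finally show ?thesis by (simp add: herm_self_eq_0_iff)
qed

text \<open>For \<open>l\<close> other than \<open>k\<close>, the squared norm of
  \<open>F l *v w\<close> is \<open>herm w (F l *v w)\<close>, which is zero by orthogonality. Only
  the \<open>k\<close>-th term of the resolution survives.\<close>

lemma component_of_eigenvector:
  assumes "X *v w = theta D k *s w" and "k \<le> D"
  shows "F k *v w = w"
proof -
  have "F l *v w = (if l = k then F k *v w else 0)" if "l \<le> D" for l
  proof (cases "l = k")
    case False
    then have "herm w (F l *v w) = 0"
      using assms that by (intro orthogonal_eigen[where m = "int D - 2 * int k"]) (auto simp: theta_of_int)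
    then show ?thesis
      using False by (simp add: herm_component_left[OF that, of w w] herm_self_eq_0_iff)
  qed simp
  then have "(\<Sum>l\<le>D. F l *v w) = (\<Sum>l\<le>D. if l = k then F k *v w else 0)"
    by (intro sum.cong) simp_all
  with assms(2) show ?thesis by (simp add: resolution)
qed

lemma norm_squared_sum: "(norm v)\<^sup>2 = (\<Sum>k\<le>D. (norm (F k *v v))\<^sup>2)"
proof -
  have "complex_of_real ((norm v)\<^sup>2) = (\<Sum>k\<le>D. herm v (F k *v v))"
    by (simp only: resolution flip: herm_sum_right herm_self)
  also have "\<dots> = (\<Sum>k\<le>D. complex_of_real ((norm (F k *v v))\<^sup>2))"
    by (intro sum.cong) (simp_all add: herm_component_left[of _ v v] herm_self)
  finally show ?thesis by (simp only: of_real_eq_iff flip: of_real_sum)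
qed

lemma component_mem:
  assumes "vec.subspace W" and "\<And>v. v \<in> W \<Longrightarrow> X *v v \<in> W" and "v \<in> W" and "k \<le> D"
  shows "F k *v v \<in> W"
  by (rule subspace_component_mem[where S = "{..D}" and t = "theta D" and X = X])
    (use assms in \<open>auto simp: eigen resolution inj_on_def\<close>)

end

text \<open>The family of projections is a parameter, since the supports for \<open>E\<close>,
  \<open>E_star\<close> and \<open>E_eps\<close> have to be compared.\<close>

definition support :: "nat \<Rightarrow> (nat \<Rightarrow> complex ^ 'a ^ 'a::finite) \<Rightarrow> (complex ^ 'a) set \<Rightarrow> nat set" where
  "support D F W = {k. k \<le> D \<and> apply_set (F k) W \<noteq> {0}}"

lemma finite_support [simp]: "finite (support D F W)"
  by (simp add: support_def)

lemma (in spectral_resolution) support_nonempty: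
  assumes "v \<in> W" "v \<noteq> 0"
  shows "support D F W \<noteq> {}"
proof
  assume "support D F W = {}"
  then have "F k *v v = 0" if "k \<le> D" for k
    using that assms(1) by (auto simp: support_def apply_set_def)
  then have "v = 0" using resolution[of v] by simp
  with assms show False by simp
qed

section \<open>Triples with the Pauli commutation relations\<close>

text \<open>The roles are asymmetric: an extreme eigenvector of \<open>X\<close> is decomposed along
  the eigenspaces of \<open>Y\<close>, while \<open>Z\<close> serves to build the ladder
  operators.\<close>

locale su2_triple =
  X: spectral_resolution D X F + Y: spectral_resolution D Y G
  for D and X Y Z :: "complex ^ 'a ^ 'a::finite" and F G +
  assumes herm_Z: "hermitian Z"
    and comm_XY: "X *v (Y *v v) - Y *v (X *v v) = (2 * \<i>) *s (Z *v v)"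
    and comm_YZ: "Y *v (Z *v v) - Z *v (Y *v v) = (2 * \<i>) *s (X *v v)"
    and comm_ZX: "Z *v (X *v v) - X *v (Z *v v) = (2 * \<i>) *s (Y *v v)"
begin

text \<open>It shows that a subspace invariant under \<open>X\<close> and \<open>Y\<close> is
  invariant under \<open>Z\<close>.\<close>

lemma Z_eq: "Z *v v = (- \<i> / 2) *s (X *v (Y *v v) - Y *v (X *v v))"
  by (simp only: comm_XY vector_smult_assoc) simp

text \<open>The commutator of \<open>X\<close> with \<open>Y + iZ\<close> is
  \<open>2(Y + iZ)\<close>. Since \<open>theta D k\<close> decreases in \<open>k\<close>, adding 2
  to the eigenvalue moves the index from \<open>k\<close> to \<open>k - 1\<close>.\<close>

lemma raise_X:
  assumes "X *v u = of_int m *s u"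
  shows "X *v (Y *v u + \<i> *s (Z *v u)) = of_int (m + 2) *s (Y *v u + \<i> *s (Z *v u))"
proof -
  have 1: "X *v (Y *v u) = of_int m *s (Y *v u) + (2 * \<i>) *s (Z *v u)"
    using comm_XY[of u] by (simp add: assms vector_scalar_commute algebra_simps)
  have 2: "X *v (Z *v u) = of_int m *s (Z *v u) - (2 * \<i>) *s (Y *v u)"
    using comm_ZX[of u] by (simp add: assms vector_scalar_commute algebra_simps)
  show ?thesis
    unfolding matrix_vector_right_distrib vector_scalar_commute 1 2
    by (simp add: vec_eq_iff algebra_simps)
qed

text \<open>\<open>X - iZ\<close> and its adjoint \<open>X + iZ\<close> are the ladder operators for
  \<open>Y\<close>. Raising refers to the eigenvalue: the index of the \<open>Y\<close>-component
  drops by one.\<close>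

definition raise :: "complex ^ 'a \<Rightarrow> complex ^ 'a" where
  "raise v = X *v v - \<i> *s (Z *v v)"

definition lower :: "complex ^ 'a \<Rightarrow> complex ^ 'a" where
  "lower v = X *v v + \<i> *s (Z *v v)"

lemma herm_lower: "herm (lower v) w = herm v (raise w)"
  using X.herm herm_Z
  by (simp add: lower_def raise_def hermitian_def herm_add_left herm_diff_right
      herm_scale_left herm_scale_right)

lemma herm_raise: "herm (raise v) w = herm v (lower w)"
  by (metis cnj_herm herm_lower)

lemma Y_raise_lower:
  assumes "Y *v u = of_int m *s u"
  shows "Y *v raise u = of_int (m + 2) *s raise u" and "Y *v lower u = of_int (m - 2) *s lower u"
proof -
  have 1: "Y *v (X *v u) = of_int m *s (X *v u) - (2 * \<i>) *s (Z *v u)"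
    using comm_XY[of u] by (simp add: assms vector_scalar_commute algebra_simps)
  have 2: "Y *v (Z *v u) = of_int m *s (Z *v u) + (2 * \<i>) *s (X *v u)"
    using comm_YZ[of u] by (simp add: assms vector_scalar_commute algebra_simps)
  show "Y *v raise u = of_int (m + 2) *s raise u" "Y *v lower u = of_int (m - 2) *s lower u"
    unfolding raise_def lower_def matrix_vector_right_distrib matrix_vector_mult_diff_distrib
      vector_scalar_commute 1 2
    by (simp_all add: vec_eq_iff algebra_simps)
qed

text \<open>Raising takes component \<open>Suc k\<close> into the eigenspace of index
  \<open>k\<close>, which only sees the \<open>k\<close>-th component of \<open>v\<close>.\<close>

lemma raise_component:
  assumes "k < D"
  shows "herm v (raise (G (Suc k) *v w)) = herm (G k *v v) (raise (G (Suc k) *v w))"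
proof -
  have "Y *v raise (G (Suc k) *v w) = of_int ((int D - 2 * int (Suc k)) + 2) *s raise (G (Suc k) *v w)"
    using assms by (intro Y_raise_lower) (simp only: Y.eigen theta_of_int Suc_leI)
  then have "G k *v raise (G (Suc k) *v w) = raise (G (Suc k) *v w)"
    using assms by (intro Y.component_of_eigenvector) (simp_all add: theta_def algebra_simps)
  then show ?thesis
    using assms Y.herm_component_left[of k v "raise (G (Suc k) *v w)"] by simp
qed

lemma lower_component:
  assumes "k < D"
  shows "herm v (lower (G k *v w)) = herm (G (Suc k) *v v) (lower (G k *v w))"
proof -
  have "Y *v lower (G k *v w) = of_int ((int D - 2 * int k) - 2) *s lower (G k *v w)"
    using assms by (intro Y_raise_lower) (simp only: Y.eigen theta_of_int less_imp_le)
  then have "G (Suc k) *v lower (G k *v w) = lower (G k *v w)"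
    using assms by (intro Y.component_of_eigenvector) (simp_all add: theta_def algebra_simps)
  then show ?thesis
    using assms Y.herm_component_left[of "Suc k" v "lower (G k *v w)"] by simp
qed

text \<open>The eigenvalue would be \<open>D + 2\<close>, outside the spectrum.\<close>

lemma raise_first: "raise (G 0 *v w) = 0"
proof (rule Y.not_eigenvalue_imp_0)
  show "Y *v raise (G 0 *v w) = of_int (int D + 2) *s raise (G 0 *v w)"
    using Y.eigen[of 0 w] by (intro Y_raise_lower) (simp add: theta_def)
qed auto

lemma lower_last: "lower (G D *v w) = 0"
proof (rule Y.not_eigenvalue_imp_0)
  show "Y *v lower (G D *v w) = of_int (- int D - 2) *s lower (G D *v w)"
    using Y.eigen[of D w] by (intro Y_raise_lower) (simp add: theta_def)
qed auto

lemma norm_component_highest: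
  assumes "r \<le> D" and u: "X *v u = theta D r *s u" and highest: "Y *v u + \<i> *s (Z *v u) = 0"
    and "k \<le> D"
  shows "(norm (G k *v u))\<^sup>2 =
    (if r \<le> k \<and> k \<le> D - r then of_nat ((D - 2 * r) choose (k - r)) * (norm (G r *v u))\<^sup>2 else 0)"
proof (rule binomial_recurrence)
  have iZ: "\<i> *s (Z *v u) = - (Y *v u)"
    using highest by (simp add: eq_neg_iff_add_eq_0 add.commute)
  \<comment> \<open>By \<open>iZ\<close>, the vector on the left is \<open>raise u\<close> for
    \<open>c = 1\<close> and \<open>lower u\<close> for \<open>c = -1\<close>.\<close>
  have component: "herm (theta D r *s u + c *s (Y *v u)) (G k *v u)
      = (theta D r + c * theta D k) * of_real ((norm (G k *v u))\<^sup>2)" if "k \<le> D" for k c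
  proof -
    have "herm (Y *v u) (G k *v u) = theta D k * herm u (G k *v u)"
      using Y.herm that by (simp add: hermitian_def Y.eigen herm_scale_right)
    then show ?thesis
      using that
      by (simp add: herm_add_left herm_scale_left Y.herm_component_left[of k u u] herm_self ring_distribs)
  qed
  have raise: "herm (raise u) (G k *v u) = (theta D r + theta D k) * of_real ((norm (G k *v u))\<^sup>2)"
    and lower: "herm (lower u) (G k *v u) = (theta D r - theta D k) * of_real ((norm (G k *v u))\<^sup>2)"
    if "k \<le> D" for k
    using component[OF that, of 1] component[OF that, of "-1"]
    by (simp_all add: raise_def lower_def u iZ)
  show "(real D - real r - real k) * (norm (G k *v u))\<^sup>2
      = (real k + 1 - real r) * (norm (G (Suc k) *v u))\<^sup>2" if "k < D" for k
  proof -
    \<comment> \<open>The pairing of the raised component \<open>Suc k\<close> with component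
      \<open>k\<close> is evaluated twice: once from \<open>raise u\<close>, once from
      \<open>lower u\<close>. The resulting factors are \<open>2 * (D - r - k)\<close> and
      \<open>2 * (k + 1 - r)\<close>.\<close>
    have "(theta D r + theta D k) * of_real ((norm (G k *v u))\<^sup>2) = herm u (lower (G k *v u))"
      using raise[of k] that by (simp add: herm_raise)
    also have "\<dots> = herm (raise (G (Suc k) *v u)) (G k *v u)"
      using that by (simp add: lower_component[of k u u] herm_raise)
    also have "\<dots> = cnj (herm (lower u) (G (Suc k) *v u))"
      using that by (simp add: herm_lower raise_component[of k u u] cnj_herm)
    also have "\<dots> = (theta D r - theta D (Suc k)) * of_real ((norm (G (Suc k) *v u))\<^sup>2)"
      using lower[of "Suc k"] that by simp
    finally have "complex_of_real ((2 * (real D - real r - real k)) * (norm (G k *v u))\<^sup>2)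
        = complex_of_real ((2 * (real k + 1 - real r)) * (norm (G (Suc k) *v u))\<^sup>2)"
      by (simp add: theta_def algebra_simps)
    then show ?thesis
      by (simp only: of_real_eq_iff mult.assoc mult_cancel_left) simp
  qed
  \<comment> \<open>At the ends one ladder operator vanishes, and the remaining factors
    \<open>theta D r - theta D 0\<close> and \<open>theta D r + theta D D\<close> both equal
    \<open>-2 * r\<close>.\<close>
  show "real r * (norm (G 0 *v u))\<^sup>2 = 0"
    using lower[of 0] by (simp add: herm_lower raise_first theta_def)
  show "real r * (norm (G D *v u))\<^sup>2 = 0"
    using raise[of D] by (simp add: herm_raise lower_last theta_def)
qed fact+

text \<open>Summing the component norms by Pythagoras gives a full row of binomial coefficients,
  with sum \<open>2 ^ (D - 2 * r)\<close>. If \<open>2 * r\<close> exceeds \<open>D\<close>, the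
  index range is empty and \<open>u\<close> is zero.\<close>

lemma norm_squared_highest:
  assumes "r \<le> D" and u: "X *v u = theta D r *s u" and highest: "Y *v u + \<i> *s (Z *v u) = 0"
  shows "(norm u)\<^sup>2 = (if 2 * r \<le> D then 2 ^ (D - 2 * r) * (norm (G r *v u))\<^sup>2 else 0)"
proof -
  have "(norm u)\<^sup>2 = (\<Sum>k\<le>D. if r \<le> k \<and> k \<le> D - r
      then of_nat ((D - 2 * r) choose (k - r)) * (norm (G r *v u))\<^sup>2 else 0)"
    by (subst Y.norm_squared_sum) (intro sum.cong norm_component_highest assms; simp)
  also have "\<dots> = (\<Sum>k\<in>{r..D-r}. of_nat ((D - 2 * r) choose (k - r)) * (norm (G r *v u))\<^sup>2)"
    by (intro sum.mono_neutral_cong_right) auto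
  also have "\<dots> = (if 2 * r \<le> D then 2 ^ (D - 2 * r) * (norm (G r *v u))\<^sup>2 else 0)"
  proof (cases "2 * r \<le> D")
    case True
    have "(\<Sum>k\<in>{r..D-r}. real ((D - 2 * r) choose (k - r)) * (norm (G r *v u))\<^sup>2)
        = (\<Sum>i\<le>D - 2 * r. real ((D - 2 * r) choose i) * (norm (G r *v u))\<^sup>2)"
      using True by (intro sum.reindex_bij_witness[of _ "\<lambda>i. i + r" "\<lambda>k. k - r"]) auto
    also have "\<dots> = real (\<Sum>i\<le>D - 2 * r. (D - 2 * r) choose i) * (norm (G r *v u))\<^sup>2"
      by (simp only: of_nat_sum sum_distrib_right)
    finally show ?thesis
      using True by (simp add: choose_row_sum)
  qed auto
  finally show ?thesis .
qed

text \<open>The vector \<open>Y u + iZ u\<close> lies in \<open>W\<close> and has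
  \<open>X\<close>-index \<open>r - 1\<close>. For positive \<open>r\<close> the minimality of
  \<open>r\<close> leaves no nonzero vector there; for \<open>r = 0\<close> its eigenvalue would be
  \<open>D + 2\<close>.\<close>

lemma highest_of_Min_support:
  assumes W: "vec.subspace W" and X: "\<And>v. v \<in> W \<Longrightarrow> X *v v \<in> W" and Y: "\<And>v. v \<in> W \<Longrightarrow> Y *v v \<in> W"
    and "u \<in> W" and u: "X *v u = theta D r *s u" and r: "r = Min (support D F W)" "r \<le> D"
  shows "Y *v u + \<i> *s (Z *v u) = 0"
proof -
  let ?w = "Y *v u + \<i> *s (Z *v u)"
  have "Z *v u \<in> W"
    unfolding Z_eq using \<open>u \<in> W\<close> by (intro vec.subspace_scale vec.subspace_diff W X Y)
  then have w: "?w \<in> W"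
    using \<open>u \<in> W\<close> by (intro vec.subspace_add vec.subspace_scale W Y)
  have eigen: "X *v ?w = of_int (int D - 2 * int r + 2) *s ?w"
    using u by (intro raise_X) (simp only: theta_of_int)
  show ?thesis
  proof (cases r)
    case 0
    then show ?thesis
      by (intro X.not_eigenvalue_imp_0[OF eigen]) auto
  next
    case (Suc k)
    then have "k \<notin> support D F W"
      using r(1) by (metis Min_le Suc_n_not_le_n finite_support)
    then have "F k *v ?w = 0"
      using w Suc r(2) by (auto simp: support_def apply_set_def)
    moreover have "F k *v ?w = ?w"
      using eigen Suc r(2) by (intro X.component_of_eigenvector) (simp_all add: theta_def algebra_simps)
    ultimately show ?thesis by simp
  qed
qed

text \<open>A nonzero \<open>u\<close> in \<open>F r W\<close> is annihilated by
  \<open>Y + iZ\<close>. Its norm is nonzero, so the norm formula forces \<open>2 * r\<close> \<le>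
  \<open>D\<close> and \<open>G r *v u\<close> nonzero; the binomial multiples of that norm then
  make every component from \<open>r\<close> to \<open>D - r\<close> nonzero.\<close>

lemma Min_support:
  assumes W: "vec.subspace W" and X: "\<And>v. v \<in> W \<Longrightarrow> X *v v \<in> W" and Y: "\<And>v. v \<in> W \<Longrightarrow> Y *v v \<in> W"
    and "W \<noteq> {0}" and r: "r = Min (support D F W)"
  shows "2 * r \<le> D" and "{r..D - r} \<subseteq> support D G W"
proof -
  obtain v where "v \<in> W" "v \<noteq> 0"
    using \<open>W \<noteq> {0}\<close> vec.subspace_0[OF W] by blast
  then have "r \<in> support D F W"
    unfolding r by (intro Min_in X.support_nonempty) auto
  then obtain w where "r \<le> D" and w: "w \<in> W" "F r *v w \<noteq> 0"
    using vec.subspace_0[OF W] by (auto simp: support_def apply_set_def image_iff) force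
  define u where "u = F r *v w"
  have u: "u \<in> W" "u \<noteq> 0" "X *v u = theta D r *s u"
    using w \<open>r \<le> D\<close> W X by (simp_all add: u_def X.eigen X.component_mem)
  have highest: "Y *v u + \<i> *s (Z *v u) = 0"
    by (rule highest_of_Min_support[OF W X Y u(1,3) r \<open>r \<le> D\<close>])
  have norm: "(norm u)\<^sup>2 = (if 2 * r \<le> D then 2 ^ (D - 2 * r) * (norm (G r *v u))\<^sup>2 else 0)"
    by (rule norm_squared_highest[OF \<open>r \<le> D\<close> u(3) highest])
  then show "2 * r \<le> D"
    using u(2) by (auto split: if_splits)
  have "G r *v u \<noteq> 0"
    using norm u(2) by (auto split: if_splits)
  then have "G k *v u \<noteq> 0" if "k \<in> {r..D - r}" for k
  proof -
    have "k \<le> D" "k - r \<le> D - 2 * r"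
      using that \<open>2 * r \<le> D\<close> by auto
    with \<open>G r *v u \<noteq> 0\<close> show ?thesis
      using norm_component_highest[OF \<open>r \<le> D\<close> u(3) highest, of k] that by auto
  qed
  then show "{r..D - r} \<subseteq> support D G W"
    using u(1) by (force simp: support_def apply_set_def)
qed

text \<open>This is the common form of all six formulas. Off the diagonal it is orthogonality of
  eigenspaces; on the diagonal it is the quotient of the norm formulas for
  \<open>G (r + i) *v u\<close> and for \<open>u\<close>.\<close>

theorem herm_components:
  assumes W: "vec.subspace W" and X: "\<And>v. v \<in> W \<Longrightarrow> X *v v \<in> W" and Y: "\<And>v. v \<in> W \<Longrightarrow> Y *v v \<in> W"
    and "W \<noteq> {0}" and r: "r = Min (support D F W)" and d: "d = D - 2 * r"
    and u: "u \<in> apply_set (F r) W" and ij: "i \<le> d" "j \<le> d"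
  shows "herm (G (r + i) *v u) (G (r + j) *v u)
    = (if i = j then 1 else 0) * of_nat (d choose i) / 2 ^ d * of_real ((norm u)\<^sup>2)"
proof (cases "i = j")
  case False
  then show ?thesis
    using Min_support(1)[OF W X Y \<open>W \<noteq> {0}\<close> r] ij d by (simp add: Y.orthogonal)
next
  case True
  have D: "2 * r \<le> D"
    by (rule Min_support(1)[OF W X Y \<open>W \<noteq> {0}\<close> r])
  then have "r \<le> D" by simp
  with u W X have "u \<in> W" and eigen: "X *v u = theta D r *s u"
    by (auto simp: apply_set_def X.eigen X.component_mem)
  have highest: "Y *v u + \<i> *s (Z *v u) = 0"
    by (rule highest_of_Min_support[OF W X Y \<open>u \<in> W\<close> eigen r \<open>r \<le> D\<close>])
  have "(norm u)\<^sup>2 = 2 ^ d * (norm (G r *v u))\<^sup>2"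
    using norm_squared_highest[OF \<open>r \<le> D\<close> eigen highest] D d by simp
  moreover have "r + i \<le> D" "r + i \<le> D - r"
    using D d ij by auto
  then have "(norm (G (r + i) *v u))\<^sup>2 = of_nat (d choose i) * (norm (G r *v u))\<^sup>2"
    using norm_component_highest[OF \<open>r \<le> D\<close> eigen highest, of "r + i"] d by simp
  ultimately have "(norm (G (r + i) *v u))\<^sup>2 = of_nat (d choose i) / 2 ^ d * (norm u)\<^sup>2"
    by simp
  then have "complex_of_real ((norm (G (r + i) *v u))\<^sup>2)
      = complex_of_real (of_nat (d choose i) / 2 ^ d * (norm u)\<^sup>2)"
    by (rule arg_cong)
  then show ?thesis
    using True by (simp add: herm_self)
qed

end

section \<open>Symmetries of a triple\<close>

lemma matrix_vector_mult_minus_left: "(- M) *v v = - (M *v v)" for M :: "'k::ring_1 ^ 'a ^ 'b"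
  by (simp add: vec_eq_iff matrix_vector_mult_def sum_negf)

lemma matrix_vector_mult_minus_right: "M *v (- v) = - (M *v v)" for M :: "'k::ring_1 ^ 'a ^ 'b"
  by (simp add: vec_eq_iff matrix_vector_mult_def sum_negf)

lemma mat_mult_vec: "mat c *v v = c *s v" for c :: "'k::comm_semiring_1"
  by (simp add: vec_eq_iff matrix_vector_mult_def mat_def if_distrib [of "\<lambda>x. x * _"] cong: if_cong)

lemma hermitian_uminus: "hermitian (- M) \<longleftrightarrow> hermitian M"
  by (simp add: hermitian_def matrix_vector_mult_minus_left herm_minus_left herm_minus_right)

text \<open>Exchanging \<open>X\<close> and \<open>Y\<close> reverses every commutator, which the
  sign of \<open>Z\<close> absorbs.\<close>

lemma (in su2_triple) swap: "su2_triple D Y X (- Z) G F"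
  using comm_XY comm_YZ comm_ZX herm_Z
  by unfold_locales
    (simp_all add: hermitian_uminus matrix_vector_mult_minus_left matrix_vector_mult_minus_right
      algebra_simps vec_eq_iff)

lemma (in su2_triple) rotate:
  assumes "spectral_resolution D Z H"
  shows "su2_triple D Y Z X G H"
  using assms X.herm comm_XY comm_YZ comm_ZX
  by (intro su2_triple.intro su2_triple_axioms.intro Y.spectral_resolution_axioms)

text \<open>The spectrum is symmetric: \<open>theta D (D - k)\<close> is
  \<open>- theta D k\<close>.\<close>

lemma (in spectral_resolution) uminus: "spectral_resolution D (- X) (\<lambda>k. F (D - k))"
proof
  show "hermitian (- X)" using herm by (simp add: hermitian_uminus)
  show "- X *v (F (D - k) *v v) = theta D k *s (F (D - k) *v v)" if "k \<le> D" for k v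
    using that eigen[of "D - k" v]
    by (simp add: matrix_vector_mult_minus_left theta_def of_nat_diff vec_eq_iff algebra_simps)
  show "(\<Sum>k\<le>D. F (D - k) *v v) = v" for v
    by (subst (2) resolution[symmetric]) (rule sum.reindex_bij_witness[of _ "\<lambda>k. D - k" "\<lambda>k. D - k"]; simp)
qed

text \<open>A quarter turn about the \<open>Z\<close> axis, sending \<open>X\<close>,
  \<open>Y\<close> to \<open>- Y\<close>, \<open>X\<close>, preserves the relations without changing
  \<open>Z\<close>.\<close>

lemma (in su2_triple) negate_swap: "su2_triple D (- Y) X Z (\<lambda>k. G (D - k)) F"
  using comm_XY comm_YZ comm_ZX herm_Z Y.uminus
  by (intro su2_triple.intro su2_triple_axioms.intro X.spectral_resolution_axioms)
    (simp_all add: matrix_vector_mult_minus_left matrix_vector_mult_minus_right algebra_simps vec_eq_iff)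

text \<open>The least index for \<open>X\<close> belongs to the support for \<open>Y\<close>, which
  gives one inequality; the swapped triple gives the other.\<close>

lemma (in su2_triple) Min_support_eq:
  assumes W: "vec.subspace W" and X: "\<And>v. v \<in> W \<Longrightarrow> X *v v \<in> W" and Y: "\<And>v. v \<in> W \<Longrightarrow> Y *v v \<in> W"
    and "W \<noteq> {0}"
  shows "Min (support D F W) = Min (support D G W)"
proof -
  interpret YX: su2_triple D Y X "- Z" G F by (rule swap)
  have le: "Min (support D G' W) \<le> Min (support D F' W)"
    if "su2_triple D X' Y' Z' F' G'" and inv: "\<And>v. v \<in> W \<Longrightarrow> X' *v v \<in> W" "\<And>v. v \<in> W \<Longrightarrow> Y' *v v \<in> W"
    for X' Y' Z' F' G'
  proof -
    interpret T: su2_triple D X' Y' Z' F' G' by fact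
    let ?r = "Min (support D F' W)"
    have "?r \<in> support D G' W"
      using T.Min_support[OF W inv \<open>W \<noteq> {0}\<close> refl] by auto
    then show ?thesis by (intro Min_le) simp
  qed
  show ?thesis
    by (intro antisym le[OF YX.su2_triple_axioms Y X] le[OF su2_triple_axioms X Y])
qed

text \<open>Passing to \<open>- Y\<close> reverses the indices but not the least one, since both
  least indices agree with that of \<open>X\<close>. Hence \<open>k\<close> in the support yields
  \<open>r\<close> \<le> \<open>D - k\<close> as well as \<open>r\<close> \<le>
  \<open>k\<close>.\<close>

lemma (in su2_triple) support_eq:
  assumes W: "vec.subspace W" and X: "\<And>v. v \<in> W \<Longrightarrow> X *v v \<in> W" and Y: "\<And>v. v \<in> W \<Longrightarrow> Y *v v \<in> W"
    and "W \<noteq> {0}" and r: "r = Min (support D G W)"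
  shows "support D G W = {r..D - r}"
proof
  interpret N: su2_triple D "- Y" X Z "\<lambda>k. G (D - k)" F by (rule negate_swap)
  have rF: "r = Min (support D F W)"
    using Min_support_eq[OF W X Y \<open>W \<noteq> {0}\<close>] r by simp
  show "{r..D - r} \<subseteq> support D G W"
    by (rule Min_support(2)[OF W X Y \<open>W \<noteq> {0}\<close> rF])
  have negY: "- Y *v v \<in> W" if "v \<in> W" for v
    using Y[OF that] W by (simp add: matrix_vector_mult_minus_left vec.subspace_neg)
  have negMin: "r = Min (support D (\<lambda>k. G (D - k)) W)"
    using N.Min_support_eq[OF W negY X \<open>W \<noteq> {0}\<close>] rF by simp
  show "support D G W \<subseteq> {r..D - r}"
  proof
    fix k assume k: "k \<in> support D G W"
    then have "D - k \<in> support D (\<lambda>k. G (D - k)) W" "k \<le> D"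
      by (auto simp: support_def)
    then have "r \<le> D - k"
      using negMin by (simp add: Min_le)
    moreover have "r \<le> k"
      using k r by (simp add: Min_le)
    ultimately show "k \<in> {r..D - r}"
      using \<open>k \<le> D\<close> by auto
  qed
qed

section \<open>The cube\<close>

definition flip :: "'n \<Rightarrow> 'n cube \<Rightarrow> 'n cube" where
  "flip k y = y(k := \<not> y k)"

definition coord_sign :: "bool \<Rightarrow> complex" where
  "coord_sign b = (if b then - 1 else 1)"

lemma flip_apply [simp]: "flip k y k = (\<not> y k)" "l \<noteq> k \<Longrightarrow> flip k y l = y l"
  by (simp_all add: flip_def)

lemma flip_flip [simp]: "flip k (flip k y) = y"
  by (simp add: flip_def)

lemma flip_commute: "flip k (flip l y) = flip l (flip k y)"
  by (auto simp: flip_def fun_eq_iff)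

lemma inj_flip: "inj (\<lambda>k. flip k y)"
  by (auto simp: inj_def flip_def fun_eq_iff split: if_splits)

lemma coord_sign_Not [simp]: "coord_sign (\<not> b) = - coord_sign b"
  and cnj_coord_sign [simp]: "cnj (coord_sign b) = coord_sign b"
  by (simp_all add: coord_sign_def)

lemma cube_adj_iff: "(y, z) \<in> cube_adj \<longleftrightarrow> z \<in> range (\<lambda>k. flip k y)"
proof
  assume "(y, z) \<in> cube_adj"
  then have "\<exists>!k. y k \<noteq> z k" by (simp add: cube_adj_def)
  then obtain k where k: "y k \<noteq> z k" and unique: "\<forall>l. y l \<noteq> z l \<longrightarrow> l = k"
    by (rule ex1E)
  have "z l = flip k y l" for l
  proof (cases "l = k")
    case True
    then show ?thesis using k by simp
  next
    case False
    then have "y l = z l" using unique by blast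
    then show ?thesis using False by simp
  qed
  then have "z = flip k y" by (rule ext)
  then show "z \<in> range (\<lambda>k. flip k y)" by blast
next
  assume "z \<in> range (\<lambda>k. flip k y)"
  then obtain k where k: "z = flip k y" by blast
  have "\<exists>!l. y l \<noteq> z l"
  proof (rule ex1I[of _ k])
    show "y k \<noteq> z k" by (simp add: k)
    show "l = k" if "y l \<noteq> z l" for l
      using that k by (cases "l = k") simp_all
  qed
  then show "(y, z) \<in> cube_adj" by (simp add: cube_adj_def)
qed

lemma cube_adj_iff': "(y, z) \<in> cube_adj \<longleftrightarrow> (\<exists>k. y = flip k z)"
proof -
  have "z = flip k y \<longleftrightarrow> y = flip k z" for k by auto
  then show ?thesis by (simp add: cube_adj_iff image_iff)
qed

lemma card_flip: "card {l. flip k y l} = (if y k then card {l. y l} - 1 else Suc (card {l. y l}))"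
  for y :: "'n::finite cube"
proof -
  have "{l. flip k y l} = (if y k then {l. y l} - {k} else insert k {l. y l})"
    by (auto simp: flip_def)
  then show ?thesis by simp
qed

text \<open>Clearing one true coordinate at a time gives a path of this length, and no edge changes
  the number of true coordinates by more than one.\<close>

lemma cube_dist_base: "cube_dist base y = card {k. y k}" for y :: "'n::finite cube"
proof -
  have upper: "(base, y) \<in> cube_adj ^^ card {k. y k}" for y :: "'n cube"
  proof (induction "card {k. y k}" arbitrary: y)
    case 0
    then have "y = base" by (auto simp: base_def)
    with 0 show ?case by simp
  next
    case (Suc m)
    then obtain k where k: "y k"
      by (metis (mono_tags) card.empty empty_Collect_eq nat.distinct(1))
    then have "m = card {l. flip k y l}"
      using Suc(2) by (simp add: card_flip)
    then have "(base, flip k y) \<in> cube_adj ^^ m"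
      using Suc(1) by simp
    moreover have "(flip k y, y) \<in> cube_adj"
      unfolding cube_adj_iff' by blast
    ultimately show ?case
      unfolding Suc(2)[symmetric] by auto
  qed
  have lower: "card {k. y k} \<le> m" if "(base, y) \<in> cube_adj ^^ m" for m and y :: "'n cube"
    using that
  proof (induction m arbitrary: y)
    case 0
    then show ?case by (auto simp: base_def)
  next
    case (Suc m)
    then obtain k z where "(base, z) \<in> cube_adj ^^ m" "y = flip k z"
      by (auto simp: cube_adj_iff)
    with Suc.IH[of z] show ?case by (auto simp: card_flip)
  qed
  show ?thesis
    unfolding cube_dist_def using upper lower by (intro Least_equality)
qed

text \<open>This is the diagonal of \<open>dual_adj_mat\<close>, written as a sum over coordinates
  so that a flip changes a single term.\<close>

definition sign_sum :: "'n::finite cube \<Rightarrow> complex" where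
  "sign_sum y = (\<Sum>k\<in>UNIV. coord_sign (y k))"

lemma sign_sum_eq: "sign_sum y = theta CARD('n) (cube_dist base y)" for y :: "'n::finite cube"
proof -
  have "sign_sum y = (\<Sum>k\<in>UNIV. 1 - 2 * of_bool (y k))"
    unfolding sign_sum_def by (intro sum.cong) (auto simp: coord_sign_def)
  also have "\<dots> = of_nat CARD('n) - 2 * (\<Sum>k\<in>UNIV. of_bool (y k))"
    by (simp only: sum_subtractf sum_distrib_left) simp
  also have "(\<Sum>k\<in>UNIV. of_bool (y k)) = complex_of_nat (card {k. y k})"
    by (simp add: of_bool_def sum.If_cases)
  finally show ?thesis
    by (simp add: cube_dist_base theta_def)
qed

lemma cnj_sign_sum: "cnj (sign_sum y) = sign_sum y"
  by (simp add: sign_sum_def)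

lemma sign_sum_flip: "sign_sum (flip k y) = sign_sum y - 2 * coord_sign (y k)"
proof -
  have "sign_sum y - sign_sum (flip k y) = (\<Sum>l\<in>UNIV. if l = k then 2 * coord_sign (y k) else 0)"
    unfolding sign_sum_def sum_subtractf[symmetric] by (intro sum.cong) auto
  then show ?thesis by (simp add: algebra_simps)
qed

lemma cube_dist_base_le: "cube_dist base y \<le> CARD('n)" for y :: "'n::finite cube"
  by (simp add: cube_dist_base card_mono)

section \<open>The three matrices in terms of coordinate flips\<close>

lemma adj_mat_component: "(adj_mat *v v) $ y = (\<Sum>k\<in>UNIV. v $ flip k y)"
proof -
  have "(adj_mat *v v) $ y = (\<Sum>z\<in>range (\<lambda>k. flip k y). v $ z)"
    unfolding adj_mat_def matrix_vector_mult_def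
    by (simp add: cube_adj_iff if_distrib [of "\<lambda>x. x * _"] sum.If_cases cong: if_cong)
  also have "\<dots> = (\<Sum>k\<in>UNIV. v $ flip k y)"
    by (simp add: sum.reindex inj_flip)
  finally show ?thesis .
qed

lemma dual_adj_mat_component: "(dual_adj_mat *v v) $ y = sign_sum y * v $ y"
  by (simp add: dual_adj_mat_def matrix_vector_mult_def sign_sum_eq theta_def
      if_distrib [of "\<lambda>x. x * _"] cong: if_cong)

lemma E_star_component: "(E_star i *v v) $ y = (if cube_dist base y = i then v $ y else 0)"
  by (cases "cube_dist base y = i")
    (simp_all add: E_star_def matrix_vector_mult_def if_distrib [of "\<lambda>x. x * _"] cong: if_cong)

text \<open>This is the matrix whose primitive idempotents are the \<open>E_eps i\<close>; it is the
  third member of the triple.\<close>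

definition eps_adj_mat :: "'n::finite cmat" where
  "eps_adj_mat = mat (- \<i> / 2) ** (adj_mat ** dual_adj_mat - dual_adj_mat ** adj_mat)"

lemma eps_adj_mat_mult_vec:
  "eps_adj_mat *v v = (- \<i> / 2) *s (adj_mat *v (dual_adj_mat *v v) - dual_adj_mat *v (adj_mat *v v))"
  by (simp add: eps_adj_mat_def mat_mult_vec matrix_vector_mult_diff_rdistrib
      flip: matrix_vector_mul_assoc)

text \<open>Commuting with a diagonal matrix multiplies the entry at the neighbour
  \<open>flip k y\<close> by the change of \<open>sign_sum\<close>, which is
  \<open>-2 * coord_sign (y k)\<close>; the factor \<open>-i / 2\<close> turns this into
  \<open>i * coord_sign (y k)\<close>.\<close>

lemma eps_adj_mat_component:
  "(eps_adj_mat *v v) $ y = (\<Sum>k\<in>UNIV. \<i> * coord_sign (y k) * v $ flip k y)"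
proof -
  have "(eps_adj_mat *v v) $ y = (\<Sum>k\<in>UNIV. - \<i> / 2 *
      (sign_sum (flip k y) * v $ flip k y - sign_sum y * v $ flip k y))"
    unfolding sum_distrib_left[symmetric] sum_subtractf
    by (simp add: eps_adj_mat_mult_vec adj_mat_component dual_adj_mat_component right_diff_distrib)
  also have "\<dots> = (\<Sum>k\<in>UNIV. \<i> * coord_sign (y k) * v $ flip k y)"
    by (intro sum.cong) (simp_all add: sign_sum_flip algebra_simps)
  finally show ?thesis .
qed

lemma sum_cube_flip: "(\<Sum>y\<in>UNIV. f (flip k y)) = (\<Sum>y\<in>UNIV. f y)" for f :: "'n::finite cube \<Rightarrow> complex"
  by (rule sum.reindex_bij_witness[of _ "flip k" "flip k"]) simp_all

lemma hermitian_adj_mat: "hermitian (adj_mat :: 'n::finite cmat)"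
proof -
  have "herm (adj_mat *v v) w = herm v (adj_mat *v w)" for v w :: "'n cvec"
  proof -
    have "herm (adj_mat *v v) w = (\<Sum>k\<in>UNIV. \<Sum>y\<in>UNIV. v $ flip k y * cnj (w $ y))"
      unfolding herm_def adj_mat_component sum_distrib_right by (rule sum.swap)
    also have "\<dots> = (\<Sum>k\<in>UNIV. \<Sum>y\<in>UNIV. v $ y * cnj (w $ flip k y))"
    proof (rule sum.cong[OF refl])
      show "(\<Sum>y\<in>UNIV. v $ flip k y * cnj (w $ y)) = (\<Sum>y\<in>UNIV. v $ y * cnj (w $ flip k y))" for k
        using sum_cube_flip[of "\<lambda>y. v $ flip k y * cnj (w $ y)" k] by simp
    qed
    also have "\<dots> = herm v (adj_mat *v w)"
      unfolding herm_def adj_mat_component cnj_sum sum_distrib_left by (rule sum.swap)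
    finally show ?thesis .
  qed
  then show ?thesis by (simp add: hermitian_def)
qed

lemma hermitian_dual_adj_mat: "hermitian dual_adj_mat"
  by (simp add: hermitian_def herm_def dual_adj_mat_component cnj_sign_sum mult_ac)

text \<open>A commutator of Hermitian matrices is skew-Hermitian, and an imaginary factor makes it
  Hermitian.\<close>

lemma hermitian_eps_adj_mat: "hermitian (eps_adj_mat :: 'n::finite cmat)"
proof -
  have A: "herm (adj_mat *v v) w = herm v (adj_mat *v w)"
    and D: "herm (dual_adj_mat *v v) w = herm v (dual_adj_mat *v w)" for v w :: "'n cvec"
    using hermitian_adj_mat hermitian_dual_adj_mat by (auto simp: hermitian_def)
  show ?thesis
    unfolding hermitian_def eps_adj_mat_mult_vec herm_scale_left herm_scale_right
      herm_diff_left herm_diff_right A D by (simp add: right_diff_distrib)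
qed

lemma spectral_dual_adj_mat: "spectral_resolution CARD('n) (dual_adj_mat :: 'n::finite cmat) E_star"
proof
  show "hermitian (dual_adj_mat :: 'n cmat)" by (rule hermitian_dual_adj_mat)
  show "dual_adj_mat *v (E_star k *v v) = theta CARD('n) k *s (E_star k *v v)" for k and v :: "'n cvec"
    by (simp add: vec_eq_iff dual_adj_mat_component E_star_component sign_sum_eq)
  show "(\<Sum>k\<le>CARD('n). E_star k *v v) = v" for v :: "'n cvec"
    by (simp add: vec_eq_iff E_star_component cube_dist_base_le)
qed

text \<open>The change of \<open>sign_sum\<close> along a flip contributes a second
  \<open>coord_sign (y k)\<close>, and the square of a sign is 1.\<close>

lemma comm_dual_eps: "dual_adj_mat *v (eps_adj_mat *v v) - eps_adj_mat *v (dual_adj_mat *v v)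
    = (2 * \<i>) *s (adj_mat *v v)"
proof -
  have "(dual_adj_mat *v (eps_adj_mat *v v) - eps_adj_mat *v (dual_adj_mat *v v)) $ y
      = 2 * \<i> * (adj_mat *v v) $ y" for y
  proof -
    have "(dual_adj_mat *v (eps_adj_mat *v v) - eps_adj_mat *v (dual_adj_mat *v v)) $ y
        = (\<Sum>k\<in>UNIV. sign_sum y * (\<i> * coord_sign (y k) * v $ flip k y)
            - \<i> * coord_sign (y k) * (sign_sum (flip k y) * v $ flip k y))"
      by (simp only: sum_subtractf dual_adj_mat_component eps_adj_mat_component
          vector_minus_component sum_distrib_left)
    also have "\<dots> = (\<Sum>k\<in>UNIV. 2 * \<i> * v $ flip k y)"
    proof (rule sum.cong[OF refl])
      show "sign_sum y * (\<i> * coord_sign (y k) * v $ flip k y)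
          - \<i> * coord_sign (y k) * (sign_sum (flip k y) * v $ flip k y) = 2 * \<i> * v $ flip k y" for k
        unfolding sign_sum_flip by (cases "y k") (simp_all add: coord_sign_def algebra_simps)
    qed
    finally show ?thesis
      by (simp add: adj_mat_component sum_distrib_left)
  qed
  then show ?thesis by (simp add: vec_eq_iff)
qed

text \<open>Both products are sums over pairs of flips. Flips of different coordinates commute and
  leave each other's signs alone, so these terms cancel. A repeated flip returns to \<open>y\<close>
  with opposite signs in the two products, so the terms double.\<close>

lemma comm_eps_adj: "eps_adj_mat *v (adj_mat *v v) - adj_mat *v (eps_adj_mat *v v)
    = (2 * \<i>) *s (dual_adj_mat *v v)"
proof -
  have "(eps_adj_mat *v (adj_mat *v v) - adj_mat *v (eps_adj_mat *v v)) $ y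
      = 2 * \<i> * (sign_sum y * v $ y)" for y
  proof -
    have "(eps_adj_mat *v (adj_mat *v v)) $ y
        = (\<Sum>k\<in>UNIV. \<Sum>l\<in>UNIV. \<i> * coord_sign (y k) * v $ flip l (flip k y))"
      by (simp add: adj_mat_component eps_adj_mat_component sum_distrib_left)
    moreover have "(adj_mat *v (eps_adj_mat *v v)) $ y
        = (\<Sum>k\<in>UNIV. \<Sum>l\<in>UNIV. \<i> * coord_sign (flip l y k) * v $ flip l (flip k y))"
      by (subst sum.swap) (simp add: adj_mat_component eps_adj_mat_component flip_commute[of k l for k l])
    moreover have "\<i> * coord_sign (y k) * v $ flip l (flip k y) - \<i> * coord_sign (flip l y k) * v $ flip l (flip k y)
        = (if l = k then 2 * \<i> * coord_sign (y k) * v $ y else 0)" for k l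
      by (cases "l = k") auto
    ultimately have "(eps_adj_mat *v (adj_mat *v v) - adj_mat *v (eps_adj_mat *v v)) $ y
        = (\<Sum>k\<in>UNIV. \<Sum>l\<in>UNIV. if l = k then 2 * \<i> * coord_sign (y k) * v $ y else 0)"
      by (simp only: vector_minus_component flip: sum_subtractf)
    also have "\<dots> = (\<Sum>k\<in>UNIV. 2 * \<i> * coord_sign (y k) * v $ y)"
      by simp
    also have "\<dots> = 2 * \<i> * (sign_sum y * v $ y)"
      unfolding sign_sum_def sum_distrib_right sum_distrib_left by (simp add: mult.assoc)
    finally show ?thesis .
  qed
  then show ?thesis by (simp add: vec_eq_iff dual_adj_mat_component)
qed

section \<open>Conjugation by \<open>P_mat\<close>\<close>

lemma P_mat_column_flip: "P_mat $ y $ flip k z = coord_sign (y k) * P_mat $ y $ z" for y :: "'n::finite cube"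
proof -
  have "(\<Prod>l\<in>UNIV. P1 (y l) (flip k z l)) = P1 (y k) (\<not> z k) * (\<Prod>l\<in>UNIV - {k}. P1 (y l) (z l))"
    by (subst prod.remove[of _ k]) (auto intro: prod.cong)
  \<comment> \<open>The rows of \<open>P1\<close> are eigenvectors of the exchange of the two
    letters, with eigenvalues 1 and -1.\<close>
  also have "P1 (y k) (\<not> z k) = coord_sign (y k) * P1 (y k) (z k)"
    by (cases "y k"; cases "z k") (simp_all add: coord_sign_def)
  finally show ?thesis
    by (simp add: P_mat_def prod.remove[of UNIV k] mult.assoc)
qed

lemma P_mat_row_flip:
  "P_mat $ flip k y $ z = - \<i> * coord_sign (y k) * coord_sign (z k) * P_mat $ y $ z" for y :: "'n::finite cube"
proof -
  have "(\<Prod>l\<in>UNIV. P1 (flip k y l) (z l)) = P1 (\<not> y k) (z k) * (\<Prod>l\<in>UNIV - {k}. P1 (y l) (z l))"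
    by (subst prod.remove[of _ k]) (auto intro: prod.cong)
  also have "P1 (\<not> y k) (z k) = - \<i> * coord_sign (y k) * coord_sign (z k) * P1 (y k) (z k)"
    by (cases "y k"; cases "z k") (simp_all add: coord_sign_def)
  finally show ?thesis
    by (simp add: P_mat_def prod.remove[of UNIV k] mult.assoc)
qed

lemma P_mat_component: "(P_mat *v v) $ y = (\<Sum>z\<in>UNIV. P_mat $ y $ z * v $ z)"
  by (simp add: matrix_vector_mult_def)

text \<open>Together with \<open>adj_mat_P_mat\<close> this says that conjugation by
  \<open>P_mat\<close> takes \<open>dual_adj_mat\<close> to \<open>adj_mat\<close> and
  \<open>adj_mat\<close> to \<open>eps_adj_mat\<close>. Here a flip is moved from \<open>v\<close>
  to the columns of \<open>P_mat\<close>, where it becomes a sign.\<close>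

lemma dual_adj_mat_P_mat: "dual_adj_mat *v (P_mat *v v) = P_mat *v (adj_mat *v v)" for v :: "'n::finite cvec"
proof -
  have "(P_mat *v (adj_mat *v v)) $ y = sign_sum y * (P_mat *v v) $ y" for y
  proof -
    have "(P_mat *v (adj_mat *v v)) $ y = (\<Sum>k\<in>UNIV. \<Sum>z\<in>UNIV. P_mat $ y $ z * v $ flip k z)"
      unfolding P_mat_component adj_mat_component sum_distrib_left by (rule sum.swap)
    also have "\<dots> = (\<Sum>k\<in>UNIV. \<Sum>z\<in>UNIV. coord_sign (y k) * (P_mat $ y $ z * v $ z))"
    proof (rule sum.cong[OF refl])
      show "(\<Sum>z\<in>UNIV. P_mat $ y $ z * v $ flip k z) = (\<Sum>z\<in>UNIV. coord_sign (y k) * (P_mat $ y $ z * v $ z))" for k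
        using sum_cube_flip[of "\<lambda>z. P_mat $ y $ z * v $ flip k z" k]
        by (simp add: P_mat_column_flip mult.assoc)
    qed
    also have "\<dots> = sign_sum y * (P_mat *v v) $ y"
      by (simp only: sign_sum_def P_mat_component sum_distrib_left sum_distrib_right)
        (rule sum.swap)
    finally show ?thesis .
  qed
  then show ?thesis by (simp add: vec_eq_iff dual_adj_mat_component)
qed

lemma adj_mat_P_mat: "adj_mat *v (P_mat *v v) = P_mat *v (eps_adj_mat *v v)" for v :: "'n::finite cvec"
proof -
  have "(P_mat *v (eps_adj_mat *v v)) $ y = (adj_mat *v (P_mat *v v)) $ y" for y
  proof -
    have "(P_mat *v (eps_adj_mat *v v)) $ y
        = (\<Sum>k\<in>UNIV. \<Sum>z\<in>UNIV. P_mat $ y $ z * (\<i> * coord_sign (z k) * v $ flip k z))"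
      unfolding P_mat_component eps_adj_mat_component sum_distrib_left by (rule sum.swap)
    also have "\<dots> = (\<Sum>k\<in>UNIV. \<Sum>z\<in>UNIV. P_mat $ flip k y $ z * v $ z)"
    proof (rule sum.cong[OF refl])
      show "(\<Sum>z\<in>UNIV. P_mat $ y $ z * (\<i> * coord_sign (z k) * v $ flip k z))
          = (\<Sum>z\<in>UNIV. P_mat $ flip k y $ z * v $ z)" for k
        using sum_cube_flip[of "\<lambda>z. P_mat $ y $ z * (\<i> * coord_sign (z k) * v $ flip k z)" k]
        by (simp add: P_mat_column_flip P_mat_row_flip mult_ac)
    qed
    also have "\<dots> = (adj_mat *v (P_mat *v v)) $ y"
      by (simp only: P_mat_component adj_mat_component)
    finally show ?thesis .
  qed
  then show ?thesis by (simp add: vec_eq_iff)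
qed

lemma matrix_inv_P_mat [simp]:
  "matrix_inv P_mat *v (P_mat *v v) = v" "P_mat *v (matrix_inv P_mat *v v) = v" for v :: "'n::finite cvec"
proof -
  have "P_mat ** matrix_inv P_mat = (mat 1 :: 'n cmat) \<and> matrix_inv P_mat ** P_mat = (mat 1 :: 'n cmat)"
    using invertible_P_mat unfolding invertible_def matrix_inv_def by (rule someI_ex)
  then show "matrix_inv P_mat *v (P_mat *v v) = v" "P_mat *v (matrix_inv P_mat *v v) = v"
    by (simp_all add: matrix_vector_mul_assoc)
qed

text \<open>Hermiticity of \<open>X'\<close> is a hypothesis because \<open>Q\<close> is only
  assumed to be invertible.\<close>

lemma (in spectral_resolution) conjugate:
  assumes "hermitian X'" and intertwine: "\<And>v. X *v (Q *v v) = Q *v (X' *v v)"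
    and inv: "\<And>v. R *v (Q *v v) = v" "\<And>v. Q *v (R *v v) = v"
    and F': "\<And>k v. k \<le> D \<Longrightarrow> F' k *v v = R *v (F k *v (Q *v v))"
  shows "spectral_resolution D X' F'"
proof
  show "X' *v (F' k *v v) = theta D k *s (F' k *v v)" if "k \<le> D" for k v
  proof -
    have "Q *v (X' *v (F' k *v v)) = Q *v (theta D k *s (F' k *v v))"
      by (simp add: F' inv eigen that vector_scalar_commute flip: intertwine)
    then show ?thesis by (metis inv(1))
  qed
  show "(\<Sum>k\<le>D. F' k *v v) = v" for v
    by (simp add: F' inv resolution flip: matrix_vector_mult_sum)
qed fact

text \<open>Since \<open>P_mat\<close> intertwines \<open>adj_mat\<close> with the diagonal
  \<open>dual_adj_mat\<close>, it turns the Lagrange polynomial \<open>E i\<close> into that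
  polynomial evaluated at the diagonal entries.\<close>

lemma P_mat_E: "P_mat *v (E i *v v) = E_star i *v (P_mat *v v)" if "i \<le> CARD('n)" for v :: "'n::finite cvec"
proof -
  let ?c = "\<lambda>j. 1 / (theta CARD('n) i - theta CARD('n) j)"
  \<comment> \<open>The list of indices is made arbitrary to allow induction on it.\<close>
  define M :: "nat list \<Rightarrow> 'n cmat" where
    "M js = foldr (\<lambda>j M. mat (?c j) ** (adj_mat - mat (theta CARD('n) j)) ** M) js (mat 1)" for js
  have M: "(P_mat *v (M js *v v)) $ y =
      (\<Prod>j\<leftarrow>js. ?c j * (sign_sum y - theta CARD('n) j)) * (P_mat *v v) $ y" for js y
  proof (induction js)
    case (Cons j js)
    have "M (j # js) *v v = ?c j *s (adj_mat *v (M js *v v) - theta CARD('n) j *s (M js *v v))"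
      by (simp add: M_def mat_mult_vec matrix_vector_mult_diff_rdistrib flip: matrix_vector_mul_assoc)
    then have "P_mat *v (M (j # js) *v v)
        = ?c j *s (dual_adj_mat *v (P_mat *v (M js *v v)) - theta CARD('n) j *s (P_mat *v (M js *v v)))"
      by (simp only: vector_scalar_commute matrix_vector_mult_diff_distrib dual_adj_mat_P_mat)
    then have "(P_mat *v (M (j # js) *v v)) $ y
        = ?c j * (sign_sum y - theta CARD('n) j) * (P_mat *v (M js *v v)) $ y"
      by (simp only: vector_smult_component vector_minus_component dual_adj_mat_component
          left_diff_distrib mult.assoc)
    then show ?case by (simp only: Cons.IH list.map prod_list.Cons mult.assoc)
  qed (simp add: M_def)
  let ?js = "filter (\<lambda>j. j \<noteq> i) [0..<Suc CARD('n)]"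
  have prod: "(\<Prod>j\<leftarrow>?js. ?c j * (sign_sum y - theta CARD('n) j)) = (if cube_dist base y = i then 1 else 0)"
    for y :: "'n cube"
  proof -
    have "(\<Prod>j\<leftarrow>?js. ?c j * (sign_sum y - theta CARD('n) j))
        = (\<Prod>j\<in>{..CARD('n)} - {i}. ?c j * (sign_sum y - theta CARD('n) j))"
    proof -
      have "distinct ?js" and "set ?js = {..CARD('n)} - {i}"
        by (auto simp del: upt_Suc)
      then show ?thesis
        using prod.distinct_set_conv_list[of ?js "\<lambda>j. ?c j * (sign_sum y - theta CARD('n) j)"] by simp
    qed
    \<comment> \<open>At distance \<open>i\<close> every factor is 1. At another distance the factor
      with \<open>j\<close> equal to it vanishes, and this \<open>j\<close> occurs because distances
      are at most \<open>CARD('n)\<close>.\<close>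
    also have "\<dots> = (if cube_dist base y = i then 1 else 0)"
      using cube_dist_base_le[of y] by (auto simp: sign_sum_eq intro!: prod.neutral)
    finally show ?thesis .
  qed
  have E_M: "E i = M ?js"
    by (simp only: E_def M_def)
  show ?thesis
    unfolding vec_eq_iff E_M M prod E_star_component by simp
qed

text \<open>The evident resolution of the diagonal matrix is transported by \<open>P_mat\<close>
  once to reach \<open>E\<close> and twice to reach \<open>E_eps\<close>.\<close>

lemma spectral_adj_mat: "spectral_resolution CARD('n) (adj_mat :: 'n::finite cmat) E"
  and spectral_eps_adj_mat: "spectral_resolution CARD('n) (eps_adj_mat :: 'n::finite cmat) E_eps"
proof -
  interpret dual: spectral_resolution "CARD('n)" "dual_adj_mat :: 'n cmat" E_star
    by (rule spectral_dual_adj_mat)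
  have "E k *v v = matrix_inv P_mat *v (E_star k *v (P_mat *v v))" if "k \<le> CARD('n)" for k and v :: "'n cvec"
    using that by (simp flip: P_mat_E)
  then show "spectral_resolution CARD('n) (adj_mat :: 'n cmat) E"
    by (intro dual.conjugate[of _ P_mat "matrix_inv P_mat"] hermitian_adj_mat dual_adj_mat_P_mat matrix_inv_P_mat)
  then interpret adj: spectral_resolution "CARD('n)" "adj_mat :: 'n cmat" E .
  have "E_eps k *v v = matrix_inv P_mat *v (E k *v (P_mat *v v))" for k and v :: "'n cvec"
    by (simp add: E_eps_def matrix_vector_mul_assoc matrix_mul_assoc)
  then show "spectral_resolution CARD('n) (eps_adj_mat :: 'n cmat) E_eps"
    by (intro adj.conjugate[of _ P_mat "matrix_inv P_mat"] hermitian_eps_adj_mat adj_mat_P_mat matrix_inv_P_mat)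
qed

lemma su2_triple_cube:
  "su2_triple CARD('n) (adj_mat :: 'n::finite cmat) dual_adj_mat eps_adj_mat E E_star"
proof (intro su2_triple.intro su2_triple_axioms.intro spectral_adj_mat spectral_dual_adj_mat
    hermitian_eps_adj_mat comm_dual_eps comm_eps_adj)
  show "adj_mat *v (dual_adj_mat *v v) - dual_adj_mat *v (adj_mat *v v) = (2 * \<i>) *s (eps_adj_mat *v v)"
    for v :: "'n cvec"
    by (simp only: eps_adj_mat_mult_vec vector_smult_assoc) simp
qed

section \<open>Modules of \<open>T_alg\<close>\<close>

lemma T_module_adj_mat:
  assumes "T_module W"
  shows "v \<in> W \<Longrightarrow> adj_mat *v v \<in> W" and "v \<in> W \<Longrightarrow> dual_adj_mat *v v \<in> W"
proof -
  have "{adj_mat, dual_adj_mat} \<subseteq> (T_alg :: 'a cmat set)"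
    unfolding T_alg_def by (rule hull_subset)
  then show "v \<in> W \<Longrightarrow> adj_mat *v v \<in> W" and "v \<in> W \<Longrightarrow> dual_adj_mat *v v \<in> W"
    using assms by (auto simp: T_module_def apply_set_def)
qed

theorem theorem11p1:
  fixes W :: "'n::finite cvec set" and r d i j :: nat
  assumes "irreducible_T_module W"
    and "r = module_endpoint W" and "d = module_diameter W"
    and "i \<le> d" and "j \<le> d"
  shows
    "(\<forall>u \<in> apply_set (E r) W. u \<noteq> 0 \<longrightarrow>
        herm (E_star (r + i) *v u) (E_star (r + j) *v u)
          = (if i = j then 1 else 0) * of_nat (d choose i) / 2 ^ d * of_real ((norm u)\<^sup>2) \<and>
        herm (E_eps (r + i) *v u) (E_eps (r + j) *v u)
          = (if i = j then 1 else 0) * of_nat (d choose i) / 2 ^ d * of_real ((norm u)\<^sup>2)) \<and>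
     (\<forall>u \<in> apply_set (E_star r) W. u \<noteq> 0 \<longrightarrow>
        herm (E_eps (r + i) *v u) (E_eps (r + j) *v u)
          = (if i = j then 1 else 0) * of_nat (d choose i) / 2 ^ d * of_real ((norm u)\<^sup>2) \<and>
        herm (E (r + i) *v u) (E (r + j) *v u)
          = (if i = j then 1 else 0) * of_nat (d choose i) / 2 ^ d * of_real ((norm u)\<^sup>2)) \<and>
     (\<forall>u \<in> apply_set (E_eps r) W. u \<noteq> 0 \<longrightarrow>
        herm (E (r + i) *v u) (E (r + j) *v u)
          = (if i = j then 1 else 0) * of_nat (d choose i) / 2 ^ d * of_real ((norm u)\<^sup>2) \<and>
        herm (E_star (r + i) *v u) (E_star (r + j) *v u)
          = (if i = j then 1 else 0) * of_nat (d choose i) / 2 ^ d * of_real ((norm u)\<^sup>2))"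
proof -
  have W: "vec.subspace W" and "W \<noteq> {0}" and mod: "T_module W"
    using assms(1) by (auto simp: irreducible_T_module_def T_module_def)
  note A = T_module_adj_mat(1)[OF mod] and D = T_module_adj_mat(2)[OF mod]
  \<comment> \<open>Each of the six ordered pairs gives a triple: the first letter is the matrix
    that provides the vector, the second the one along which it is decomposed. \<open>AD\<close>,
    \<open>DE\<close>, \<open>EA\<close> are cyclic rotations, the others their swaps.\<close>
  interpret AD: su2_triple "CARD('n)" adj_mat "dual_adj_mat :: 'n cmat" eps_adj_mat E E_star
    by (rule su2_triple_cube)
  interpret DE: su2_triple "CARD('n)" "dual_adj_mat :: 'n cmat" eps_adj_mat adj_mat E_star E_eps
    by (rule AD.rotate[OF spectral_eps_adj_mat])
  interpret EA: su2_triple "CARD('n)" "eps_adj_mat :: 'n cmat" adj_mat dual_adj_mat E_eps E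
    by (rule DE.rotate[OF spectral_adj_mat])
  interpret DA: su2_triple "CARD('n)" "dual_adj_mat :: 'n cmat" adj_mat "- eps_adj_mat" E_star E
    by (rule AD.swap)
  interpret ED: su2_triple "CARD('n)" "eps_adj_mat :: 'n cmat" dual_adj_mat "- adj_mat" E_eps E_star
    by (rule DE.swap)
  interpret AE: su2_triple "CARD('n)" "adj_mat :: 'n cmat" eps_adj_mat "- dual_adj_mat" E E_eps
    by (rule EA.swap)
  have E: "eps_adj_mat *v v \<in> W" if "v \<in> W" for v
    unfolding eps_adj_mat_mult_vec using that by (intro vec.subspace_scale vec.subspace_diff W A D)
  have support: "module_support W = support CARD('n) E_star W"
    by (simp add: module_support_def support_def)
  \<comment> \<open>The endpoint is defined through \<open>E_star\<close>; the next two facts carry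
    it over to \<open>E\<close> and \<open>E_eps\<close>.\<close>
  have r_dual: "r = Min (support CARD('n) E_star W)"
    by (simp add: assms(2) module_endpoint_def support)
  have r_adj: "r = Min (support CARD('n) E W)"
    using AD.Min_support_eq[OF W A D \<open>W \<noteq> {0}\<close>] r_dual by simp
  have r_eps: "r = Min (support CARD('n) E_eps W)"
    using DE.Min_support_eq[OF W D E \<open>W \<noteq> {0}\<close>] r_dual by simp
  have "2 * r \<le> CARD('n)"
    by (rule AD.Min_support(1)[OF W A D \<open>W \<noteq> {0}\<close> r_adj])
  \<comment> \<open>The support is \<open>{r..CARD('n) - r}\<close>, with
    \<open>CARD('n) - 2 * r + 1\<close> elements.\<close>
  then have d: "d = CARD('n) - 2 * r"
    by (simp add: assms(3) module_diameter_def support AD.support_eq[OF W A D \<open>W \<noteq> {0}\<close> r_dual])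
  \<comment> \<open>The triples \<open>AD\<close>, \<open>AE\<close> give (i), \<open>DE\<close>,
    \<open>DA\<close> give (ii), and \<open>EA\<close>, \<open>ED\<close> give (iii).\<close>
  show ?thesis
    using AD.herm_components[OF W A D \<open>W \<noteq> {0}\<close> r_adj d _ assms(4,5)]
      AE.herm_components[OF W A E \<open>W \<noteq> {0}\<close> r_adj d _ assms(4,5)]
      DE.herm_components[OF W D E \<open>W \<noteq> {0}\<close> r_dual d _ assms(4,5)]
      DA.herm_components[OF W D A \<open>W \<noteq> {0}\<close> r_dual d _ assms(4,5)]
      EA.herm_components[OF W E A \<open>W \<noteq> {0}\<close> r_eps d _ assms(4,5)]
      ED.herm_components[OF W E D \<open>W \<noteq> {0}\<close> r_eps d _ assms(4,5)]
    by blast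
qed

end
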